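(* Let $H$ be any graph of order $r$, $2\leq r\leq n$, without isolated vertices, and let $G$ be a generalized corona of $H$ having exactly $n$ leaves. For each $\ell$ with $0\leq \ell\leq n$, $D_{r+\ell}^t(G)$ is isomorphic to the subgraph of $Q_n$ induced by the collection of all $k$-subsets, $0\leq k\leq \ell$, of an $n$-set.
   Context: A generalized corona of a graph $H$ is a graph obtained by joining each vertex of $H$ to one or more new leaves (vertices of degree $1$). The hypercube $Q_n$ is the graph whose vertices are the $2^n$ subsets of an $n$-set, two being adjacent if and only if one is obtained from the other by deleting a single element. A total dominating set (TDS) of a graph without isolated vertices is a vertex set $S$ such that every vertex is adjacent to a vertex of $S$. For a positive integer $k$, $D_k^t(G)$ is the graph whose vertices are the TDSs of $G$ of cardinality at most $k$, two being adjacent if and only if one is obtained from the other by adding or deleting a single vertex. *)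

theory Defs
  imports "Graph_Theory.Graph_Theory"
begin

text \<open>
  A finite simple graph is a \<open>pair_graph\<close>, an edge \<open>uv\<close> being the two arcs \<open>(u, v)\<close> and
  \<open>(v, u)\<close>. The degree of a vertex is therefore its \<open>out_degree\<close>.
\<close>

definition no_isolated_vertices :: "'a pair_pre_digraph \<Rightarrow> bool" where
  "no_isolated_vertices G \<longleftrightarrow> (\<forall>v\<in>pverts G. out_degree (with_proj G) v \<noteq> 0)"

definition leaves :: "'a pair_pre_digraph \<Rightarrow> 'a set" where
  "leaves G = {v \<in> pverts G. out_degree (with_proj G) v = 1}"

definition attach :: "'a pair_pre_digraph \<Rightarrow> ('a \<Rightarrow> 'a set) \<Rightarrow> 'a pair_pre_digraph" where
  "attach H L = \<lparr>
     pverts = pverts H \<union> (\<Union>v\<in>pverts H. L v),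
     parcs = parcs H \<union> (\<Union>v\<in>pverts H. {v} \<times> L v \<union> L v \<times> {v}) \<rparr>"

text \<open>
  \<open>L v\<close> is the set of new vertices joined to \<open>v\<close>. They have degree 1 in \<open>attach H L\<close> because
  the sets \<open>L v\<close> are pairwise disjoint and contain no vertex of \<open>H\<close>.
\<close>

definition generalized_corona :: "'a pair_pre_digraph \<Rightarrow> 'a pair_pre_digraph \<Rightarrow> bool" where
  "generalized_corona H G \<longleftrightarrow>
     (\<exists>L. (\<forall>v\<in>pverts H. L v \<noteq> {} \<and> finite (L v) \<and> L v \<inter> pverts H = {}) \<and>
          disjoint_family_on L (pverts H) \<and>
          G = attach H L)"

definition hypercube :: "nat \<Rightarrow> nat set pair_pre_digraph" where
  "hypercube n = \<lparr>
     pverts = Pow {1..n},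
     parcs = {(A, B). A \<in> Pow {1..n} \<and> B \<in> Pow {1..n} \<and>
                      ((\<exists>x\<in>A. B = A - {x}) \<or> (\<exists>x\<in>B. A = B - {x}))} \<rparr>"

definition total_dominating_set :: "'a pair_pre_digraph \<Rightarrow> 'a set \<Rightarrow> bool" where
  "total_dominating_set G S \<longleftrightarrow>
     S \<subseteq> pverts G \<and> (\<forall>v\<in>pverts G. \<exists>u\<in>S. v \<rightarrow>\<^bsub>with_proj G\<^esub> u)"

text \<open>The graph \<open>D\<^sub>k\<^sup>t(G)\<close>.\<close>

definition total_dominating_graph :: "nat \<Rightarrow> 'a pair_pre_digraph \<Rightarrow> 'a set pair_pre_digraph" where
  "total_dominating_graph k G =
     (let V = {S. total_dominating_set G S \<and> card S \<le> k}
      in \<lparr> pverts = V,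
           parcs = {(S, T). S \<in> V \<and> T \<in> V \<and>
                            ((\<exists>x. x \<notin> S \<and> T = insert x S) \<or> (\<exists>x\<in>S. T = S - {x}))} \<rparr>)"

end

theory Submission
  imports Defs
begin

text \<open>
  A leaf forces its only neighbour into every total dominating set, and every vertex of \<open>H\<close> carries
  a leaf. Conversely, a set containing all vertices of \<open>H\<close> dominates the leaves, and also \<open>H\<close>
  itself because \<open>H\<close> has no isolated vertex. So the total dominating sets are the sets
  \<open>V(H) \<union> A\<close> with \<open>A\<close> an arbitrary set of leaves, and \<open>V(H) \<union> A \<mapsto> A\<close> is the isomorphism.
\<close>

text \<open>\<open>digraph_iso\<close> asks for a record with separate vertex and arc maps. Arcs of
  a pair digraph are pairs of vertices, so a vertex bijection \<open>f\<close> preserving and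
  reflecting arcs determines the arc map \<open>map_prod f f\<close>. \<open>K\<close> is an
  arbitrary digraph record because the intended target is an induced subgraph rather than a
  \<open>with_proj\<close> term.\<close>

lemma digraph_iso_with_projI:
  assumes "pair_wf_digraph P"
    and bij: "bij_betw f (pverts P) (verts K)"
    and "tail K = fst" and "head K = snd"
    and wfK: "arcs K \<subseteq> verts K \<times> verts K"
    and arcs: "\<And>u v. u \<in> pverts P \<Longrightarrow> v \<in> pverts P \<Longrightarrow> (f u, f v) \<in> arcs K \<longleftrightarrow> (u, v) \<in> parcs P"
  shows "digraph_iso (with_proj P) K"
proof -
  interpret pair_wf_digraph P by fact
  have inj: "inj_on f (pverts P)" and img: "f ` pverts P = verts K"
    using bij by (auto simp: bij_betw_def)
  \<comment> \<open>The fields \<open>iso_head\<close> and \<open>iso_tail\<close> become the head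
    and tail of the image, so they are chosen to agree with those of \<open>K\<close>.\<close>
  define hom where "hom = \<lparr>iso_verts = f, iso_arcs = map_prod f f, iso_head = snd, iso_tail = fst\<rparr>"
  have "inj_on (map_prod f f) (parcs P)"
    by (rule inj_on_subset[OF map_prod_inj_on[OF inj inj]]) (auto dest: wellformed')
  then have "pre_digraph.digraph_isomorphism (with_proj P) hom"
    using inj wf_digraph by (simp add: pre_digraph.digraph_isomorphism_def hom_def)
  moreover have "arcs K = map_prod f f ` parcs P"
  proof (intro equalityI subrelI)
    fix a b assume ab: "(a, b) \<in> arcs K"
    then obtain u v where uv: "a = f u" "u \<in> pverts P" "b = f v" "v \<in> pverts P"
      using wfK img by blast
    then have "(u, v) \<in> parcs P"
      using ab arcs by simp
    then show "(a, b) \<in> map_prod f f ` parcs P"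
      using uv by force
  qed (use arcs wellformed' in auto)
  then have "K = app_iso hom (with_proj P)"
    using assms img by (intro pre_digraph.equality) (simp_all add: hom_def)
  ultimately show ?thesis
    unfolding digraph_iso_def by blast
qed

text \<open>Inclusion and the size of a difference are exactly what an injective image preserves, so
  adjacency is put in these terms for both graphs.\<close>

lemma insert_notin_iff: "(\<exists>x. x \<notin> A \<and> B = insert x A) \<longleftrightarrow> A \<subseteq> B \<and> card (B - A) = 1"
  unfolding One_nat_def card_1_singleton_iff by blast

lemma remove_in_iff: "(\<exists>x\<in>A. B = A - {x}) \<longleftrightarrow> B \<subseteq> A \<and> card (A - B) = 1"
  unfolding One_nat_def card_1_singleton_iff by blast

lemma parcs_hypercube:
  "(A, B) \<in> parcs (hypercube n) \<longleftrightarrow> A \<subseteq> {1..n} \<and> B \<subseteq> {1..n} \<and>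
     (A \<subseteq> B \<and> card (B - A) = 1 \<or> B \<subseteq> A \<and> card (A - B) = 1)"
  unfolding hypercube_def by (auto simp: remove_in_iff)

lemma parcs_total_dominating_graph:
  "(S, T) \<in> parcs (total_dominating_graph k G) \<longleftrightarrow>
     S \<in> pverts (total_dominating_graph k G) \<and> T \<in> pverts (total_dominating_graph k G) \<and>
     (S \<subseteq> T \<and> card (T - S) = 1 \<or> T \<subseteq> S \<and> card (S - T) = 1)"
  unfolding total_dominating_graph_def Let_def by (auto simp: remove_in_iff insert_notin_iff)

lemma pverts_total_dominating_graph:
  "pverts (total_dominating_graph k G) = {S. total_dominating_set G S \<and> card S \<le> k}"
  by (simp add: total_dominating_graph_def)

lemma pair_wf_total_dominating_graph: "pair_wf_digraph (total_dominating_graph k G)"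
  by unfold_locales (auto simp: parcs_total_dominating_graph)

text \<open>Fixes the witness \<open>L\<close> hidden by the existential in
  \<open>generalized_corona\<close>.\<close>

locale corona = pair_graph H for H :: "'a pair_pre_digraph" +
  fixes L :: "'a \<Rightarrow> 'a set"
  assumes no_isolated: "no_isolated_vertices H"
    and L_nonempty: "v \<in> pverts H \<Longrightarrow> L v \<noteq> {}"
    and finite_L: "v \<in> pverts H \<Longrightarrow> finite (L v)"
    and L_new: "v \<in> pverts H \<Longrightarrow> L v \<inter> pverts H = {}"
    and disjoint_L: "disjoint_family_on L (pverts H)"
begin

lemma neighbour_exists:
  assumes "v \<in> pverts H"
  obtains u where "(v, u) \<in> parcs H"
proof -
  have "out_arcs (with_proj H) v \<noteq> {}"
    using no_isolated assms by (auto simp: no_isolated_vertices_def out_degree_def)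
  then show thesis
    using that by (auto simp: out_arcs_def)
qed

text \<open>No arc of \<open>H\<close> starts at \<open>x\<close>, which lies outside
  \<open>H\<close>, and disjointness of the sets \<open>L w\<close> leaves \<open>v\<close> as the
  only vertex to which \<open>x\<close> was attached.\<close>

lemma attach_arc_from_new:
  assumes "v \<in> pverts H" and "x \<in> L v"
  shows "(x, u) \<in> parcs (attach H L) \<longleftrightarrow> u = v"
proof -
  have x: "x \<notin> pverts H"
    using assms L_new by auto
  have unique: "w = v" if "w \<in> pverts H" "x \<in> L w" for w
    using that assms disjoint_L by (auto simp: disjoint_family_on_def)
  have "(x, u) \<in> parcs (attach H L) \<longleftrightarrow>
      (x, u) \<in> parcs H \<or> (\<exists>w\<in>pverts H. x = w \<and> u \<in> L w \<or> x \<in> L w \<and> u = w)"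
    by (simp add: attach_def)
  also have "\<dots> \<longleftrightarrow> u \<in> pverts H \<and> x \<in> L u"
    using x in_arcsD1 by blast
  also have "\<dots> \<longleftrightarrow> u = v"
    using unique assms by blast
  finally show ?thesis .
qed

text \<open>Identifies the leaves, defined by degree, with the new vertices. A vertex of
  \<open>H\<close> never has degree 1: it has a neighbour in \<open>H\<close> and another one in its
  nonempty \<open>L v\<close>.\<close>

lemma leaves_attach: "leaves (attach H L) = (\<Union>v\<in>pverts H. L v)"
proof -
  have "out_degree (with_proj (attach H L)) x = 1" if "v \<in> pverts H" "x \<in> L v" for v x
  proof -
    have "(a, b) \<in> out_arcs (with_proj (attach H L)) x \<longleftrightarrow> (a, b) = (x, v)" for a b
      using attach_arc_from_new[OF that, of b] by (cases "a = x") (simp_all add: out_arcs_def)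
    then have "out_arcs (with_proj (attach H L)) x = {(x, v)}"
      by (simp add: set_eq_iff)
    then show ?thesis
      by (simp add: out_degree_def)
  qed
  moreover have "out_degree (with_proj (attach H L)) v \<noteq> 1" if v: "v \<in> pverts H" for v
  proof
    assume "out_degree (with_proj (attach H L)) v = 1"
    then obtain e where e: "out_arcs (with_proj (attach H L)) v = {e}"
      unfolding out_degree_def by (rule card_1_singletonE)
    obtain u where u: "(v, u) \<in> parcs H"
      using v by (rule neighbour_exists)
    obtain x where x: "x \<in> L v"
      using L_nonempty[OF v] by blast
    have "(v, u) \<in> {e}" "(v, x) \<in> {e}"
      unfolding e[symmetric] out_arcs_def attach_def using u x v by (simp_all, blast)
    then have "u = x"
      by auto
    then show False
      using in_arcsD2[OF u] x L_new[OF v] by blast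
  qed
  moreover have "pverts (attach H L) = pverts H \<union> (\<Union>v\<in>pverts H. L v)"
    by (simp add: attach_def)
  ultimately show ?thesis
    unfolding leaves_def by blast
qed

lemma pverts_attach: "pverts (attach H L) = pverts H \<union> leaves (attach H L)"
  unfolding leaves_attach by (simp add: attach_def)

lemma leaves_disjoint: "leaves (attach H L) \<inter> pverts H = {}"
  using L_new by (auto simp: leaves_attach)

lemma finite_leaves: "finite (leaves (attach H L))"
  using finite_L pair_finite_verts by (simp add: leaves_attach)

lemma total_dominating_set_attach:
  "total_dominating_set (attach H L) S \<longleftrightarrow>
     pverts H \<subseteq> S \<and> S \<subseteq> pverts H \<union> leaves (attach H L)"
proof (intro iffI conjI subsetI)
  fix v assume S: "total_dominating_set (attach H L) S" and v: "v \<in> pverts H"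
  obtain x where x: "x \<in> L v"
    using L_nonempty[OF v] by blast
  then have "x \<in> pverts (attach H L)"
    using v by (auto simp: attach_def)
  then obtain u where "u \<in> S" "(x, u) \<in> parcs (attach H L)"
    using S by (auto simp: total_dominating_set_def)
  \<comment> \<open>The vertex \<open>u\<close> dominating \<open>x\<close> can only be
    \<open>v\<close>.\<close>
  then show "v \<in> S"
    using attach_arc_from_new[OF v x] by simp
next
  fix x assume "total_dominating_set (attach H L) S" "x \<in> S"
  then show "x \<in> pverts H \<union> leaves (attach H L)"
    by (auto simp: total_dominating_set_def pverts_attach)
next
  assume S: "pverts H \<subseteq> S \<and> S \<subseteq> pverts H \<union> leaves (attach H L)"
  have "\<exists>u\<in>S. (v, u) \<in> parcs (attach H L)" if v: "v \<in> pverts (attach H L)" for v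
  proof (cases "v \<in> pverts H")
    case True
    then obtain u where "(v, u) \<in> parcs H"
      by (rule neighbour_exists)
    then show ?thesis
      using S by (auto simp: attach_def dest: wellformed')
  next
    case False
    then obtain w where "w \<in> pverts H" "v \<in> L w"
      using v by (auto simp: attach_def)
    then show ?thesis
      using S attach_arc_from_new by blast
  qed
  then show "total_dominating_set (attach H L) S"
    using S by (simp add: total_dominating_set_def pverts_attach)
qed

lemma total_dominating_graph_iso:
  assumes "card (leaves (attach H L)) = n"
  shows "digraph_iso
           (with_proj (total_dominating_graph (card (pverts H) + l) (attach H L)))
           (with_proj (hypercube n) \<restriction> (\<Union>k\<in>{0..l}. {A. A \<subseteq> {1..n} \<and> card A = k}))"
    (is "digraph_iso (with_proj ?D) ?Q")
proof -
  let ?V = "pverts H" and ?X = "leaves (attach H L)"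
  obtain f where f: "bij_betw f ?X {1..n}"
    using finite_same_card_bij[OF finite_leaves, of "{1..n}"] assms by auto
  then have inj: "inj_on f ?X" and img: "f ` ?X = {1..n}"
    by (auto simp: bij_betw_def)
  have finV: "finite ?V"
    by (rule pair_finite_verts)
  \<comment> \<open>Drop the forced vertices of \<open>H\<close>, then rename the remaining leaves
    by \<open>1..n\<close>.\<close>
  let ?F = "\<lambda>S. f ` (S - ?V)"
  \<comment> \<open>The forced part contributes \<open>card ?V\<close> to the size, so the bound
    \<open>card ?V + l\<close> on \<open>S\<close> becomes the bound \<open>l\<close> on its set of
    leaves.\<close>
  have D: "S \<in> pverts ?D \<longleftrightarrow> ?V \<subseteq> S \<and> S - ?V \<subseteq> ?X \<and> card (S - ?V) \<le> l" for S
  proof -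
    have "card S = card ?V + card (S - ?V)" if "?V \<subseteq> S" "S - ?V \<subseteq> ?X"
    proof -
      have "finite S"
        using that finV finite_leaves by (metis finite_Diff2 finite_subset)
      then show ?thesis
        using that finV by (simp add: card_Diff_subset card_mono)
    qed
    then show ?thesis
      by (auto simp: pverts_total_dominating_graph total_dominating_set_attach Diff_subset_conv)
  qed
  have Q: "A \<in> verts ?Q \<longleftrightarrow> A \<subseteq> {1..n} \<and> card A \<le> l" for A
    by auto
  have card_F: "card (f ` A) = card A" if "A \<subseteq> ?X" for A
    using that inj by (meson card_image inj_on_subset)
  have maps: "?F S \<in> verts ?Q" if "S \<in> pverts ?D" for S
    using that card_F[of "S - ?V"] image_mono[of "S - ?V" ?X f] unfolding D Q img by simp
  \<comment> \<open>Both sets contain \<open>?V\<close>, so removing it changes neither their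
    inclusion nor their difference. What remains consists of leaves, where \<open>f\<close> is
    injective.\<close>
  have sub: "?F S \<subseteq> ?F T \<longleftrightarrow> S \<subseteq> T" and diff: "card (?F T - ?F S) = card (T - S)"
    if "S \<in> pverts ?D" "T \<in> pverts ?D" for S T
  proof -
    have ST: "?V \<subseteq> S" "S - ?V \<subseteq> ?X" "?V \<subseteq> T" "T - ?V \<subseteq> ?X"
      using that by (auto simp: D)
    have "?F S \<subseteq> ?F T \<longleftrightarrow> S - ?V \<subseteq> T - ?V"
      using inj ST(2,4) unfolding inj_on_def by blast
    then show "?F S \<subseteq> ?F T \<longleftrightarrow> S \<subseteq> T"
      using ST(1,3) by blast
    have "?F T - ?F S = f ` ((T - ?V) - (S - ?V))"
      by (rule inj_on_image_set_diff[OF inj subset_trans[OF Diff_subset ST(4)] ST(2), symmetric])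
    also have "(T - ?V) - (S - ?V) = T - S"
      using ST(1) by blast
    finally have "?F T - ?F S = f ` (T - S)" .
    moreover have "T - S \<subseteq> ?X"
      using ST(1,4) by blast
    ultimately show "card (?F T - ?F S) = card (T - S)"
      by (simp only: card_F)
  qed
  have "bij_betw ?F (pverts ?D) (verts ?Q)"
    unfolding bij_betw_def
  proof
    show "inj_on ?F (pverts ?D)"
      \<comment> \<open>Equal images include each other, hence so do the sets themselves.\<close>
      using sub by (intro inj_onI) (metis order_refl subset_antisym)
    show "?F ` pverts ?D = verts ?Q"
    proof (intro equalityI subsetI)
      fix A assume "A \<in> verts ?Q"
      then have A: "A \<subseteq> {1..n}" "card A \<le> l"
        unfolding Q by simp_all
      then obtain B where B: "B \<subseteq> ?X" "A = f ` B"
        using img by (metis subset_imageE)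
      \<comment> \<open>The preimage of \<open>A\<close> is \<open>?V \<union> B\<close>; as leaves
        lie outside \<open>H\<close>, removing \<open>?V\<close> recovers \<open>B\<close>.\<close>
      then have "(?V \<union> B) - ?V = B"
        using leaves_disjoint by blast
      moreover from this have "?V \<union> B \<in> pverts ?D"
        using A B card_F by (simp add: D)
      ultimately show "A \<in> ?F ` pverts ?D"
        using B by (metis image_eqI)
    qed (use maps in blast)
  qed
  \<comment> \<open>Adjacency on each side is inclusion one way with a difference of size 1, which
    \<open>sub\<close> and \<open>diff\<close> transfer.\<close>
  moreover have "(?F S, ?F T) \<in> arcs ?Q \<longleftrightarrow> (S, T) \<in> parcs ?D"
    if "S \<in> pverts ?D" "T \<in> pverts ?D" for S T
    using that maps[OF that(1)] maps[OF that(2)]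
    by (simp add: parcs_hypercube parcs_total_dominating_graph sub diff)
  moreover have "arcs ?Q \<subseteq> verts ?Q \<times> verts ?Q"
    by auto
  ultimately show ?thesis
    by (intro digraph_iso_with_projI[where f = ?F] pair_wf_total_dominating_graph) simp_all
qed

end

theorem theorem4p1:
  fixes H G :: "'a pair_pre_digraph" and r n l :: nat
  assumes "pair_graph H"
    and "card (pverts H) = r"
    and "2 \<le> r" and "r \<le> n"
    and "no_isolated_vertices H"
    and "generalized_corona H G"
    and "card (leaves G) = n"
    and "0 \<le> l" and "l \<le> n"
  shows "digraph_iso
           (with_proj (total_dominating_graph (r + l) G))
           (with_proj (hypercube n) \<restriction> (\<Union>k\<in>{0..l}. {A. A \<subseteq> {1..n} \<and> card A = k}))"
proof -
  obtain L where L: "\<forall>v\<in>pverts H. L v \<noteq> {} \<and> finite (L v) \<and> L v \<inter> pverts H = {}"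
      "disjoint_family_on L (pverts H)" "G = attach H L"
    using \<open>generalized_corona H G\<close> by (auto simp: generalized_corona_def)
  interpret corona H L
    using assms(1,5) L by (simp add: corona_def corona_axioms_def)
  show ?thesis
    using total_dominating_graph_iso[of n l] assms(2,7) L(3) by simp
qed

end
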